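(* Let $T(V,E,w)$ be a star-convex tree, with set of leaf vertices $V_{\ell}$ and core $C=C(T)$. Then $$\max_{v\in V} w(v)=\max_{v\in V_{\ell}\cup C} w(v)\qquad\text{and}\qquad \min_{v\in V} w(v)=\min_{v\in V_{\ell}\cup C} w(v).$$
   Context: All graphs are finite. A weighted tree $T(V,E,w)$ is a tree with vertex set $V$, edge set $E$ and a vertex-weight function $w:V\to\mathbb{R}_{+}$, where $\mathbb{R}_+$ is the set of non-negative reals. $V_{\ell}$ denotes the set of vertices of degree exactly $1$ (leaf vertices). A path $x_0,x_1,\dots,x_k$ is weighted-monotone if $w(x_0)\le w(x_1)\le\cdots\le w(x_k)$ or $w(x_0)\ge w(x_1)\ge\cdots\ge w(x_k)$ (a one-vertex path is trivially weighted-monotone). A weighted graph with non-empty $V_{\ell}$ is star-convex if there exists a vertex $u\in V$ such that for every $v\in V_{\ell}$ there is a weighted-monotone path connecting $u$ and $v$. The set of all such vertices $u$ is the core $C(T)$. *)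

theory Defs
  imports Complex_Main "Graph_Theory.Graph_Theory"
begin

text \<open>
  Finite simple graphs are symmetric, loop-free digraphs without parallel arcs
  (locale \<^locale>\<open>graph\<close>): an undirected edge is a pair of opposite arcs. Since going back and
  forth along one edge is then a closed arc walk, with pairwise distinct vertices after the first,
  the library's notions of cycle-freeness (and hence of a tree) would exclude every edge. The cycles
  of the undirected graph are the directed cycles of length at least 3.
\<close>

locale undirected_tree = graph G for G :: "('a, 'b) pre_digraph" (structure) +
  assumes connected: "Digraph_Component.connected G"
    and no_undirected_cycle: "\<not> (\<exists>p. cycle p \<and> length p \<ge> 3)"

locale weighted_tree = undirected_tree G for G :: "('a, 'b) pre_digraph" (structure) +
  fixes w :: "'a \<Rightarrow> real"
  assumes weight_nonneg: "v \<in> verts G \<Longrightarrow> 0 \<le> w v"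

text \<open>
  In a symmetric digraph representing a simple graph, the out-degree of a vertex is its degree in
  the undirected graph.
\<close>

definition leaf_verts :: "('a, 'b) pre_digraph \<Rightarrow> 'a set" where
  "leaf_verts G = {v \<in> verts G. out_degree G v = 1}"

definition weighted_monotone :: "('a \<Rightarrow> real) \<Rightarrow> 'a list \<Rightarrow> bool" where
  "weighted_monotone w p \<longleftrightarrow> sorted_wrt (\<le>) (map w p) \<or> sorted_wrt (\<ge>) (map w p)"

definition monotone_connected :: "('a, 'b) pre_digraph \<Rightarrow> ('a \<Rightarrow> real) \<Rightarrow> 'a \<Rightarrow> 'a \<Rightarrow> bool" where
  "monotone_connected G w u v \<longleftrightarrow>
     (\<exists>p. vpath p G \<and> hd p = u \<and> last p = v \<and> weighted_monotone w p)"

definition core :: "('a, 'b) pre_digraph \<Rightarrow> ('a \<Rightarrow> real) \<Rightarrow> 'a set" where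
  "core G w = {u \<in> verts G. \<forall>v \<in> leaf_verts G. monotone_connected G w u v}"

definition star_convex :: "('a, 'b) pre_digraph \<Rightarrow> ('a \<Rightarrow> real) \<Rightarrow> bool" where
  "star_convex G w \<longleftrightarrow> leaf_verts G \<noteq> {} \<and>
     (\<exists>u \<in> verts G. \<forall>v \<in> leaf_verts G. monotone_connected G w u v)"

end

theory Submission
  imports Defs
begin

text \<open>
  Take any vertex \<open>u\<close> of the core. Every other vertex \<open>x\<close> lies on a path from \<open>u\<close> to a leaf
  (\<open>vpath_extends_to_leaf\<close>): a path from \<open>u\<close> to \<open>x\<close> can be prolonged until it gets stuck, and in
  a tree a path gets stuck only at a leaf, since a further neighbour of its last vertex on the path
  would close a cycle. By definition of the core some path from \<open>u\<close> to that leaf is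
  weighted-monotone, and because paths in a tree are determined by their ends (\<open>vpath_unique\<close>), it
  is the path through \<open>x\<close>. Hence \<open>w x\<close> lies between the weights of \<open>u\<close> and of the leaf, and neither
  the maximum nor the minimum of \<open>w\<close> changes when the remaining vertices are discarded.
\<close>

text \<open>
  Weighted-monotone paths are vertex lists, whereas cycles are lists of arcs; this connects the two.
\<close>

lemma (in wf_digraph) vwalk_imp_awalk:
  assumes "vwalk p G"
  shows "\<exists>q. awalk (hd p) q (last p) \<and> awalk_verts (hd p) q = p"
  using assms
proof (induct p)
  case (Base u)
  then show ?case by (intro exI[of _ "[]"]) (simp add: awalk_Nil_iff)
next
  case (Cons u v es)
  then obtain q where q: "awalk v q (last (v # es))" "awalk_verts v q = v # es" by auto
  from Cons(1) obtain e where "e \<in> arcs G" "tail G e = u" "head G e = v" by (rule reachableE)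
  with q show ?case by (intro exI[of _ "e # q"]) (simp add: awalk_Cons_iff)
qed

lemma vwalk_append:
  assumes "vwalk (p @ [z]) G" "vwalk (z # q) G"
  shows "vwalk (p @ z # q) G"
  using vwalk_joinI_vwalk[OF assms] by (simp add: vwalk_join_def)

context undirected_tree
begin

text \<open>
  The form in which acyclicity gets used: an arc between the ends of a path with at least two edges
  would turn it into a cycle.
\<close>

lemma vpath_ends_not_adjacent:
  assumes "vpath p G" "3 \<le> length p"
  shows "(last p, hd p) \<notin> arcs_ends G"
proof
  assume arc: "(last p, hd p) \<in> arcs_ends G"
  have "vwalk (last p # p) G" using assms arc by (auto intro: vwalk_wf_digraph_consI)
  from vwalk_imp_awalk[OF this] obtain q
    where q: "awalk (last p) q (last p)" "awalk_verts (last p) q = last p # p"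
    using assms by (auto split: if_splits)
  have len: "length q = length p" using arg_cong[OF q(2), of length] by (simp add: length_awalk_verts)
  have "cycle q" unfolding cycle_def using q assms len by (auto simp: vpath_def)
  with no_undirected_cycle len assms show False by auto
qed

text \<open>
  If two paths with common ends separate at \<open>u\<close>, following the first one until it meets the second
  one again and returning along the second one gives a path whose ends are adjacent.
\<close>

lemma vpath_unique:
  assumes "vpath p G" "vpath q G" "hd p = hd q" "last p = last q"
  shows "p = q"
  using assms
proof (induct p arbitrary: q)
  case Nil
  then show ?case by auto
next
  case (Cons u p')
  from Cons.prems obtain q' where q: "q = u # q'" by (cases q) auto
  show ?case
  proof (cases "p' = [] \<or> q' = []")
    case True
    with Cons.prems q show ?thesis
      by (metis distinct.simps(2) last_ConsL last_ConsR last_in_set vpathE)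
  next
    case False
    then have ne: "p' \<noteq> []" "q' \<noteq> []" by auto
    have paths: "vpath p' G" "vpath q' G" and out: "u \<notin> set p'" "u \<notin> set q'"
      and arc: "(u, hd q') \<in> arcs_ends G"
      using Cons.prems ne q by (auto simp: vpath_def elim!: vwalk_consE)
    have lst: "last p' = last q'" using Cons.prems ne q by simp
    show ?thesis
    proof (cases "hd p' = hd q'")
      case True
      with Cons.hyps paths lst q show ?thesis by simp
    next
      case heads: False
      have "\<exists>x\<in>set p'. x \<in> set q'" using ne lst by (metis last_in_set)
      then obtain a z b where p': "p' = a @ z # b" and z: "z \<in> set q'"
        and a: "\<forall>y\<in>set a. y \<notin> set q'"
        using split_list_first_prop[of p' "\<lambda>y. y \<in> set q'"] by blast
      from z obtain c d where q': "q' = c @ z # d" by (blast dest: split_list)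
      define r where "r = (u # a) @ z # rev c"
      have "vwalk ((u # a) @ [z]) G"
        using Cons.prems(1) p' by (intro vwalkI_append_l[of "(u # a) @ [z]" b]) auto
      moreover have "vwalk (z # rev c) G"
      proof -
        have "vwalk (c @ [z]) G"
          using paths(2) q' by (intro vwalkI_append_l[of "c @ [z]" d]) auto
        from vwalk_rev_ex[OF sym_arcs this] show ?thesis by simp
      qed
      ultimately have "vwalk r G" unfolding r_def by (rule vwalk_append)
      moreover have "distinct r" using paths out a p' q' by (auto simp: r_def vpath_def)
      ultimately have "vpath r G" ..
      \<comment> \<open>\<open>a\<close> and \<open>c\<close> cannot both be empty, as then \<open>z\<close> would be the head of \<open>p'\<close> and of \<open>q'\<close>.\<close>
      moreover have "3 \<le> length r"
        using heads p' q' by (cases a; cases c) (auto simp: r_def)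
      moreover have "last r = hd q'" "hd r = u"
        using q' by (auto simp: r_def last_rev hd_append)
      ultimately show ?thesis
        using vpath_ends_not_adjacent[of r] arcs_ends_symmetric[OF sym_arcs arc] by simp
    qed
  qed
qed

text \<open>
  The last vertex is adjacent to its predecessor; by \<open>vpath_ends_not_adjacent\<close> it is adjacent to no
  earlier vertex of the path. Simplicity of the graph turns this single neighbour into a single
  arc.
\<close>

lemma stuck_vpath_ends_in_leaf:
  assumes "vpath p G" "2 \<le> length p"
    and stuck: "\<And>y. (last p, y) \<in> arcs_ends G \<Longrightarrow> y \<in> set p"
  shows "last p \<in> leaf_verts G"
proof -
  obtain ys a v where p: "p = ys @ [a, v]"
    using assms(2) by (metis One_nat_def Suc_1 append.assoc append_Cons append_Nil length_0_conv
        length_append_singleton not_less_eq_eq nle_le rev_exhaust)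
  have "vwalk ([a, v]) G"
    using assms(1) p by (intro vwalkI_append_r[of "[a, v]" ys]) auto
  then have va: "(v, a) \<in> arcs_ends G"
    using sym_arcs by (auto intro: arcs_ends_symmetric)
  have only: "y = a" if y: "(v, y) \<in> arcs_ends G" for y
  proof (rule ccontr)
    assume "y \<noteq> a"
    moreover have "y \<noteq> v" using y adj_not_same by blast
    ultimately have "y \<in> set ys" using stuck y p by auto
    then obtain c d where ys: "ys = c @ y # d" by (blast dest: split_list)
    have "vpath (y # d @ [a, v]) G"
      using assms(1) p ys vwalkI_append_r[of "y # d @ [a, v]" c] by (auto simp: vpath_def)
    from vpath_ends_not_adjacent[OF this] y show False by simp
  qed
  from va obtain e where e: "e \<in> arcs G" "tail G e = v" "head G e = a" by (rule reachableE)
  have "e' = e" if e': "e' \<in> arcs G" "tail G e' = v" for e'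
  proof -
    have "head G e' = a" using only e' by (auto simp: arcs_ends_conv)
    with e e' show ?thesis by (intro no_multi_arcs) (simp_all add: arc_to_ends_def)
  qed
  with e have "out_arcs G v = {e}" unfolding out_arcs_def by blast
  then have "out_degree G v = 1" by (simp add: out_degree_def)
  moreover have "v \<in> verts G" using va adj_in_verts by blast
  ultimately show ?thesis by (simp add: leaf_verts_def p)
qed

text \<open>
  A longest path among those that extend \<open>p\<close> is stuck.
\<close>

lemma vpath_extends_to_leaf:
  assumes "vpath p G" "2 \<le> length p"
  shows "\<exists>r. vpath (p @ r) G \<and> last (p @ r) \<in> leaf_verts G"
proof -
  let ?R = "{r. vpath (p @ r) G}"
  have "finite ?R"
    using finite_vimageI[OF vpaths_finite, of "(@) p"] by (simp add: vimage_def inj_def)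
  moreover have "[] \<in> ?R" using assms by simp
  ultimately obtain r where r: "vpath (p @ r) G"
    and longest: "\<And>s. vpath (p @ s) G \<Longrightarrow> length s \<le> length r"
    using ex_has_greatest_nat[of "\<lambda>r. vpath (p @ r) G" "[]" length "Suc (Max (length ` ?R))"]
    by (auto simp: less_Suc_eq_le)
  have "last (p @ r) \<in> leaf_verts G"
  proof (rule stuck_vpath_ends_in_leaf[OF r])
    show "2 \<le> length (p @ r)" using assms(2) by simp
    fix y assume y: "(last (p @ r), y) \<in> arcs_ends G"
    show "y \<in> set (p @ r)"
    proof (rule ccontr)
      assume new: "y \<notin> set (p @ r)"
      have "last (p @ r) \<in> verts G" "y \<in> verts G" using y adj_in_verts by blast+
      with y r have "vwalk ((p @ r) @ [y]) G"
        by (auto simp: vpath_def vwalk_def set_vwalk_arcs_snoc simp del: append_assoc)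
      with new r have "vpath (p @ (r @ [y])) G" by (auto simp: vpath_def)
      from longest[OF this] show False by simp
    qed
  qed
  with r show ?thesis by blast
qed

lemma vert_on_vpath_to_leaf:
  assumes "u \<in> verts G" "x \<in> verts G" "x \<noteq> u"
  shows "\<exists>p. vpath p G \<and> hd p = u \<and> x \<in> set p \<and> last p \<in> leaf_verts G"
proof -
  have "u \<rightarrow>\<^sup>* x"
    using symmetric_connected_imp_strongly_connected[OF sym_arcs connected] assms
    by (simp add: strongly_connected_def)
  then obtain p where p: "vpath p G" "hd p = u" "last p = x"
    by (auto simp: reachable_vpath_conv)
  then have ne: "p \<noteq> []" by auto
  with p assms(3) have "2 \<le> length p" by (cases p rule: list.exhaust; cases "tl p") auto
  from vpath_extends_to_leaf[OF p(1) this] obtain r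
    where "vpath (p @ r) G" "last (p @ r) \<in> leaf_verts G" by blast
  with p ne show ?thesis by (intro exI[of _ "p @ r"]) (auto simp: hd_append)
qed

end

lemma weighted_monotone_between_ends:
  assumes "weighted_monotone w p" "x \<in> set p"
  shows "min (w (hd p)) (w (last p)) \<le> w x \<and> w x \<le> max (w (hd p)) (w (last p))"
proof -
  from assms(2) obtain a b where p: "p = a @ x # b" by (blast dest: split_list)
  have "w (hd p) \<le> w x \<and> w x \<le> w (last p) \<or> w x \<le> w (hd p) \<and> w (last p) \<le> w x"
    using assms(1) unfolding weighted_monotone_def p
    by (cases a; cases b rule: rev_cases) (auto simp: sorted_wrt_append)
  then show ?thesis by auto
qed

lemma (in undirected_tree) weight_between_core_and_leaf:
  assumes "u \<in> core G w" "x \<in> verts G" "x \<noteq> u"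
  shows "\<exists>v\<in>leaf_verts G. min (w u) (w v) \<le> w x \<and> w x \<le> max (w u) (w v)"
proof -
  have "u \<in> verts G" using assms(1) by (simp add: core_def)
  from vert_on_vpath_to_leaf[OF this assms(2,3)] obtain p
    where p: "vpath p G" "hd p = u" "x \<in> set p" "last p \<in> leaf_verts G" by blast
  with assms(1) obtain q
    where q: "vpath q G" "hd q = u" "last q = last p" "weighted_monotone w q"
    unfolding core_def monotone_connected_def by blast
  have "p = q" using vpath_unique p q by metis
  with weighted_monotone_between_ends[OF q(4)] p show ?thesis by metis
qed

lemma Max_Min_image_eq_subset:
  fixes f :: "'a \<Rightarrow> 'b :: linorder"
  assumes "finite A" "B \<subseteq> A" "B \<noteq> {}"
    and "\<And>x. x \<in> A \<Longrightarrow> \<exists>y\<in>B. f x \<le> f y" "\<And>x. x \<in> A \<Longrightarrow> \<exists>y\<in>B. f y \<le> f x"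
  shows "Max (f ` A) = Max (f ` B) \<and> Min (f ` A) = Min (f ` B)"
proof -
  have fin: "finite (f ` A)" "finite (f ` B)"
    using assms(1,2) by (auto intro: finite_subset)
  have ne: "f ` A \<noteq> {}" "f ` B \<noteq> {}" using assms(2,3) by auto
  have sub: "f ` B \<subseteq> f ` A" using assms(2) by blast
  have "Max (f ` A) \<le> Max (f ` B)"
  proof (rule Max.boundedI[OF _ ne(1)])
    fix a assume "a \<in> f ` A"
    then obtain y where "y \<in> B" "a \<le> f y" using assms(4) by blast
    with fin show "a \<le> Max (f ` B)" by (auto intro: order_trans Max_ge)
  qed fact
  moreover have "Min (f ` B) \<le> Min (f ` A)"
  proof (rule Min.boundedI[OF _ ne(1)])
    fix a assume "a \<in> f ` A"
    then obtain y where "y \<in> B" "f y \<le> a" using assms(5) by blast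
    with fin show "Min (f ` B) \<le> a" by (auto intro: order_trans[rotated] Min_le)
  qed fact
  ultimately show ?thesis
    using Max_mono[OF sub ne(2) fin(1)] Min_antimono[OF sub ne(2) fin(1)] by (simp add: antisym)
qed

theorem proposition1p5:
  fixes G :: "('a, 'b) pre_digraph" and w :: "'a \<Rightarrow> real"
  assumes "weighted_tree G w"
    and "star_convex G w"
  shows "Max (w ` verts G) = Max (w ` (leaf_verts G \<union> core G w)) \<and>
         Min (w ` verts G) = Min (w ` (leaf_verts G \<union> core G w))"
proof -
  interpret weighted_tree G w by fact
  from assms(2) obtain u where u: "u \<in> core G w"
    by (auto simp: star_convex_def core_def)
  have between: "\<exists>y\<in>leaf_verts G \<union> core G w. \<exists>z\<in>leaf_verts G \<union> core G w. w y \<le> w x \<and> w x \<le> w z"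
    if x: "x \<in> verts G" for x
  proof (cases "x = u")
    case True
    with u show ?thesis by blast
  next
    case False
    from weight_between_core_and_leaf[OF u x this] obtain v where "v \<in> leaf_verts G"
      "min (w u) (w v) \<le> w x" "w x \<le> max (w u) (w v)" by blast
    with u show ?thesis by (auto simp: min_le_iff_disj le_max_iff_disj)
  qed
  have "leaf_verts G \<union> core G w \<subseteq> verts G" by (auto simp: leaf_verts_def core_def)
  moreover have "leaf_verts G \<union> core G w \<noteq> {}" using u by blast
  ultimately show ?thesis
    using between by (intro Max_Min_image_eq_subset) (simp, assumption, assumption, blast, blast)
qed

end
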